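(* Let $A\in\mathbb{C}^{n\times m}$. For all $x_0\in\mathbb{C}^m$ and $C>0$, if Weak PhaseLift is $C$-stable at $x_0$, then PhaseCut is $(2C+2\sqrt{2}+1)$-stable at $x_0$.
   Context: $\mathbf{H}_n$ is the set of $n\times n$ complex Hermitian matrices and $\mathbf{H}_n^+$ the subset of positive semidefinite ones. $A^\dagger$ is the Moore-Penrose pseudoinverse of $A$ and $\mathbf{I}$ is the identity matrix. For a matrix, $\|\cdot\|_s$ is the Schatten $s$-norm (so $\|\cdot\|_2$ is the Frobenius norm and $\|\cdot\|_1$ the trace norm); for a vector, $\|\cdot\|_2$ is the Euclidean norm. $|Ax_0|$ is the vector of entrywise moduli. For a set $S\subset\mathbf{H}_n$, $d_s(V,S)=\inf_{W\in S}\|V-W\|_s$. Define $$\mathcal{F}=\{V\in\mathbf{H}_n: (\mathbf{I}-AA^\dagger)V(\mathbf{I}-AA^\dagger)=0\},\qquad \mathcal{H}_b=\{V\in\mathbf{H}_n: V_{ii}=b_i^2,\ i=1,\ldots,n\}\quad (b\in\mathbb{R}^n).$$ For $b\in\mathbb{R}^n$: - the PhaseCut problem is: minimize $d_1(V,\mathcal{F})$ subject to $V\in\mathbf{H}_n^+\cap\mathcal{H}_b$; - the Weak PhaseLift problem is: minimize $d_s(V,\mathcal{H}_b)$ subject to $V\in\mathbf{H}_n^+\cap\mathcal{F}$, where $s\ge 1$ is fixed and arbitrary. Definition ($C$-stability). Let $x_0\in\mathbb{C}^m$ and $C>0$. PhaseCut (resp. Weak PhaseLift) is said to be $C$-stable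 at $x_0$ iff for all $b_{\mathrm{noise}}\in\mathbb{R}^n$ close enough to zero, every minimizer $V$ of the PhaseCut (resp. Weak PhaseLift) problem with $b=|Ax_0|+b_{\mathrm{noise}}$ satisfies $$\|V-(Ax_0)(Ax_0)^*\|_2\le C\,\|Ax_0\|_2\,\|b_{\mathrm{noise}}\|_2 .$$
   Formalization: The formal theorem assumes A ≠ 0; for A = 0 the claim is false, since Weak PhaseLift is then C-stable for every C while PhaseCut has nonzero minimizers such as diag(b_i^2) and the required bound is 0. *)

theory Defs
  imports "HOL-Analysis.Analysis" "HOL-Computational_Algebra.Fundamental_Theorem_Algebra"
begin

(* An n x m complex matrix has type complex^'m^'n: rows are indexed by 'n, columns by 'm. *)

definition conj_transpose :: "complex^'m^'n \<Rightarrow> complex^'n^'m" where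
  "conj_transpose M = map_matrix cnj (transpose M)"

definition hermitian_mats :: "(complex^'n^'n) set" where
  "hermitian_mats = {V. conj_transpose V = V}"

(* For Hermitian V the sum below is the real number x^* V x, so taking Re loses nothing. *)
definition psd_mats :: "(complex^'n^'n) set" where
  "psd_mats = {V \<in> hermitian_mats. \<forall>x. 0 \<le> Re (\<Sum>i\<in>UNIV. cnj (x $ i) * (V *v x) $ i)}"

(* The rank-one matrix v v^*. *)
definition rank_one :: "complex^'n \<Rightarrow> complex^'n^'n" where
  "rank_one v = (\<chi> i j. v $ i * cnj (v $ j))"

definition entrywise_cmod :: "complex^'n \<Rightarrow> real^'n" where
  "entrywise_cmod v = (\<chi> i. cmod (v $ i))"

(* The four Penrose equations, which determine X uniquely. *)
definition is_pinv :: "complex^'m^'n \<Rightarrow> complex^'n^'m \<Rightarrow> bool" where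
  "is_pinv M X \<longleftrightarrow> M ** X ** M = M \<and> X ** M ** X = X
     \<and> conj_transpose (M ** X) = M ** X \<and> conj_transpose (X ** M) = X ** M"

definition pinv :: "complex^'m^'n \<Rightarrow> complex^'n^'m" where
  "pinv M = (THE X. is_pinv M X)"

(* det (t I - M) in the polynomial ring; [:0, 1:] is the indeterminate t. *)
definition char_polynomial :: "complex^'n^'n \<Rightarrow> complex poly" where
  "char_polynomial M = det (mat [:0, 1:] - map_matrix (\<lambda>c. [:c:]) M)"

(* Square roots of the eigenvalues of M^* M, counted with algebraic multiplicity.
   These eigenvalues are real and nonnegative, so taking Re loses nothing. *)
definition singular_values :: "complex^'m^'n \<Rightarrow> real multiset" where
  "singular_values M =
     image_mset (\<lambda>z. sqrt (Re z)) (proots (char_polynomial (conj_transpose M ** M)))"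

definition schatten_norm :: "real \<Rightarrow> complex^'m^'n \<Rightarrow> real" where
  "schatten_norm s M = (\<Sum>\<sigma>\<in>#singular_values M. \<sigma> powr s) powr (1 / s)"

definition schatten_dist :: "real \<Rightarrow> complex^'n^'n \<Rightarrow> (complex^'n^'n) set \<Rightarrow> real" where
  "schatten_dist s V S = (INF W\<in>S. schatten_norm s (V - W))"

definition set_F :: "complex^'m^'n \<Rightarrow> (complex^'n^'n) set" where
  "set_F A = {V \<in> hermitian_mats. (mat 1 - A ** pinv A) ** V ** (mat 1 - A ** pinv A) = 0}"

definition set_H :: "real^'n \<Rightarrow> (complex^'n^'n) set" where
  "set_H b = {V \<in> hermitian_mats. \<forall>i. V $ i $ i = complex_of_real ((b $ i)\<^sup>2)}"

definition phasecut_minimizer :: "complex^'m^'n \<Rightarrow> real^'n \<Rightarrow> complex^'n^'n \<Rightarrow> bool" where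
  "phasecut_minimizer A b V \<longleftrightarrow>
     is_arg_min (\<lambda>V. schatten_dist 1 V (set_F A)) (\<lambda>V. V \<in> psd_mats \<inter> set_H b) V"

definition weak_phaselift_minimizer ::
    "real \<Rightarrow> complex^'m^'n \<Rightarrow> real^'n \<Rightarrow> complex^'n^'n \<Rightarrow> bool" where
  "weak_phaselift_minimizer s A b V \<longleftrightarrow>
     is_arg_min (\<lambda>V. schatten_dist s V (set_H b)) (\<lambda>V. V \<in> psd_mats \<inter> set_F A) V"

(* Stability with constant C at x0, where minimizer b V says that V solves the problem
   with data b. *)
definition stable_at ::
    "(real^'n \<Rightarrow> complex^'n^'n \<Rightarrow> bool) \<Rightarrow> complex^'m^'n \<Rightarrow> real \<Rightarrow> complex^'m \<Rightarrow> bool" where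
  "stable_at minimizer A C x0 \<longleftrightarrow>
     (\<forall>\<^sub>F b_noise in nhds 0. \<forall>V. minimizer (entrywise_cmod (A *v x0) + b_noise) V \<longrightarrow>
        schatten_norm 2 (V - rank_one (A *v x0)) \<le> C * norm (A *v x0) * norm b_noise)"

definition phasecut_stable :: "complex^'m^'n \<Rightarrow> real \<Rightarrow> complex^'m \<Rightarrow> bool" where
  "phasecut_stable A C x0 \<longleftrightarrow> stable_at (phasecut_minimizer A) A C x0"

definition weak_phaselift_stable :: "real \<Rightarrow> complex^'m^'n \<Rightarrow> real \<Rightarrow> complex^'m \<Rightarrow> bool" where
  "weak_phaselift_stable s A C x0 \<longleftrightarrow> stable_at (weak_phaselift_minimizer s A) A C x0"

end

theory Submission
  imports Defs
begin

text \<open>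
  Let \<open>P = A A\<^sup>\<dagger>\<close>, \<open>Q = I - P\<close>, \<open>y = A x0\<close>, and let \<open>V = B\<^sup>* B\<close> be a PhaseCut minimizer
  for \<open>b = |y| + e\<close>. For such a \<open>V\<close> the objective is \<open>d\<^sub>1(V, F) = tr (Q V Q) = \<parallel>B Q\<parallel>\<^sup>2\<close>, and comparison with
  \<open>v v\<^sup>*\<close>, where \<open>v\<close> has the moduli \<open>|b|\<close> and the phases of \<open>y\<close>, gives \<open>\<parallel>B Q\<parallel> \<le> \<parallel>e\<parallel>\<close>.
  The matrix \<open>P V P\<close> lies in \<open>F\<close>, so it solves Weak PhaseLift, with objective 0, for the data \<open>c\<close> given by
  the column norms of \<open>B P\<close>. The column norms of \<open>B\<close> are \<open>|b|\<close>, hence \<open>\<parallel>c - |y|\<parallel> \<le> 2 \<parallel>e\<parallel>\<close> and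
  \<open>\<parallel>P V P - y y\<^sup>*\<parallel> \<le> 2 C \<parallel>y\<parallel> \<parallel>e\<parallel>\<close>. The remainder is \<open>P V Q + Q V P + Q V Q\<close>; its first two terms
  are orthogonal of norm at most \<open>\<parallel>B P\<parallel> \<parallel>B Q\<parallel>\<close> and the last has norm at most \<open>\<parallel>e\<parallel>\<^sup>2\<close>, which yields
  the constant \<open>2 C + 2 sqrt 2 + 1\<close> once \<open>\<parallel>e\<parallel> \<le> \<parallel>y\<parallel>\<close>. If \<open>y = 0\<close>, Weak PhaseLift is not stable at all.
\<close>

section \<open>Adjoints, the Hermitian form and Gram matrices\<close>

lemma conj_transpose_nth [simp]: "conj_transpose M $ i $ j = cnj (M $ j $ i)"
  by (simp add: conj_transpose_def transpose_def)

lemma conj_transpose_conj_transpose [simp]: "conj_transpose (conj_transpose M) = M"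
  by (simp add: vec_eq_iff)

lemma conj_transpose_mult: "conj_transpose (M ** N) = conj_transpose N ** conj_transpose M"
  by (simp add: vec_eq_iff matrix_matrix_mult_def mult.commute)

lemma conj_transpose_add: "conj_transpose (M + N) = conj_transpose M + conj_transpose N"
  and conj_transpose_diff: "conj_transpose (M - N) = conj_transpose M - conj_transpose N"
  and conj_transpose_zero [simp]: "conj_transpose 0 = 0"
  by (simp_all add: vec_eq_iff)

lemma conj_transpose_mat_1 [simp]: "conj_transpose (mat 1) = mat 1"
  by (simp add: vec_eq_iff mat_def)

lemma matrix_diff_ldistrib: "M ** (N - K) = M ** N - M ** K"
  and matrix_diff_rdistrib: "(N - K) ** L = N ** L - K ** L"
  for M N K L :: "'a::ring_1 ^ _ ^ _"
  by (simp_all add: vec_eq_iff matrix_matrix_mult_def algebra_simps sum_subtractf)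

lemma matrix_add_rdistrib: "(N + K) ** L = N ** L + K ** L"
  for N K L :: "'a::semiring_1 ^ _ ^ _"
  by (simp add: vec_eq_iff matrix_matrix_mult_def distrib_right sum.distrib)

lemma hermitian_iff: "V \<in> hermitian_mats \<longleftrightarrow> conj_transpose V = V"
  by (simp add: hermitian_mats_def)

lemma hermitian_gram: "conj_transpose B ** B \<in> hermitian_mats"
  by (simp add: hermitian_iff conj_transpose_mult)

lemma hermitian_diff: "V \<in> hermitian_mats \<Longrightarrow> W \<in> hermitian_mats \<Longrightarrow> V - W \<in> hermitian_mats"
  by (simp add: hermitian_iff conj_transpose_diff)

text \<open>The product \<open>\<bullet>\<close> on \<open>complex^'n\<close> is only the real part
  of this form. It suffices for Rayleigh quotients, but the unitarity of an eigenvector matrix needs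
  orthogonality in the complex sense.\<close>

definition cinner :: "complex^'n \<Rightarrow> complex^'n \<Rightarrow> complex" where
  "cinner x y = (\<Sum>i\<in>UNIV. cnj (x $ i) * y $ i)"

lemma Re_cinner: "Re (cinner x y) = x \<bullet> y"
  by (simp add: cinner_def inner_vec_def inner_complex_def)

lemma cinner_self: "cinner x x = of_real ((norm x)\<^sup>2)"
proof -
  have "cinner x x = of_real (\<Sum>i\<in>UNIV. (cmod (x $ i))\<^sup>2)"
    by (simp add: cinner_def complex_norm_square mult.commute del: of_real_power)
  then show ?thesis
    by (simp add: norm_vec_def L2_set_def sum_nonneg del: of_real_sum of_real_power)
qed

lemma cinner_conj_transpose: "cinner x (M *v y) = cinner (conj_transpose M *v x) y"
  unfolding cinner_def matrix_vector_mult_def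
  by (simp add: sum_distrib_left sum_distrib_right) (subst sum.swap, simp add: mult_ac)

lemma cinner_commute: "cinner y x = cnj (cinner x y)"
  by (simp add: cinner_def mult.commute)

lemma cinner_add: "cinner z (x + y) = cinner z x + cinner z y"
  and cinner_diff: "cinner z (x - y) = cinner z x - cinner z y"
  and cinner_scaleR: "cinner z (r *\<^sub>R x) = of_real r * cinner z x"
  unfolding cinner_def vector_scaleR_component
  unfolding scaleR_conv_of_real
  by (simp_all add: algebra_simps sum.distrib sum_subtractf sum_distrib_left)

lemma cinner_scaleR_left: "cinner (r *\<^sub>R z) x = of_real r * cinner z x"
  unfolding cinner_def vector_scaleR_component
  unfolding scaleR_conv_of_real
  by (simp add: algebra_simps sum_distrib_left)

lemma continuous_on_cinner [continuous_intros]: "continuous_on S (\<lambda>x. cinner z x)"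
  unfolding cinner_def by (intro continuous_intros)

lemma inner_conj_transpose: "x \<bullet> (M *v y) = (conj_transpose M *v x) \<bullet> y"
  by (metis Re_cinner cinner_conj_transpose)

lemma psd_iff: "V \<in> psd_mats \<longleftrightarrow> V \<in> hermitian_mats \<and> (\<forall>x. 0 \<le> x \<bullet> (V *v x))"
  by (simp add: psd_mats_def cinner_def flip: Re_cinner)

lemma psd_gram: "conj_transpose B ** B \<in> psd_mats"
proof -
  have "x \<bullet> ((conj_transpose B ** B) *v x) = (B *v x) \<bullet> (B *v x)" for x
    by (simp add: inner_conj_transpose flip: matrix_vector_mul_assoc)
  then show ?thesis
    by (simp add: psd_iff hermitian_gram)
qed

text \<open>First-order condition at a minimum: the quadratic vanishes at \<open>t = 0\<close>, so
  its derivative \<open>a\<close> there must be zero. It is applied below to perturbations of a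
  maximiser of the Rayleigh quotient.\<close>

lemma linear_coeff_zero:
  fixes a c :: real
  assumes "\<And>t. 0 \<le> t * a + t\<^sup>2 * c"
  shows "a = 0"
proof (rule ccontr)
  assume "a \<noteq> 0"
  \<comment> \<open>With this \<open>t\<close> the linear term equals
    \<open>- t\<^sup>2 * (\<bar>c\<bar> + 1)\<close>, which outweighs a quadratic term of at most
    \<open>t\<^sup>2 * \<bar>c\<bar>\<close>.\<close>
  define t where "t = - a / (\<bar>c\<bar> + 1)"
  have "t * a + t\<^sup>2 * c \<le> t * a + t\<^sup>2 * \<bar>c\<bar>"
    by (intro add_left_mono mult_left_mono) auto
  also have "\<dots> = t\<^sup>2 * \<bar>c\<bar> - t\<^sup>2 * (\<bar>c\<bar> + 1)"
  proof -
    have "t * (\<bar>c\<bar> + 1) = - a" unfolding t_def by simp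
    then have "t * a = - (t * (t * (\<bar>c\<bar> + 1)))" by simp
    then show ?thesis by (simp add: power2_eq_square algebra_simps)
  qed
  also have "\<dots> < 0"
  proof -
    have "t \<noteq> 0" using \<open>a \<noteq> 0\<close> unfolding t_def by simp
    then show ?thesis by (simp add: algebra_simps)
  qed
  finally show False
    using assms[of t] by simp
qed

section \<open>The spectral theorem for Hermitian matrices\<close>

text \<open>The maximiser of the Rayleigh quotient on the invariant subspace
  orthogonal to \<open>u j\<close>, \<open>j \<in> S\<close>, is an eigenvector.\<close>
lemma hermitian_eigenvector_orthogonal:
  fixes H :: "complex^'n^'n"
  assumes H: "H \<in> hermitian_mats" and S: "S \<noteq> (UNIV :: 'n set)"
    and eig: "\<And>j. j \<in> S \<Longrightarrow> H *v u j = l j *\<^sub>R u j"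
  obtains x r where "norm x = 1" "H *v x = r *\<^sub>R x" "\<And>j. j \<in> S \<Longrightarrow> cinner (u j) x = 0"
proof -
  define W where "W = {x. \<forall>j\<in>S. cinner (u j) x = 0}"
  have HW: "H *v x \<in> W" if "x \<in> W" for x
    using H that eig
    by (auto simp: W_def cinner_conj_transpose hermitian_iff cinner_scaleR_left)
  have W_lin: "x + y \<in> W" "x - y \<in> W" "r *\<^sub>R x \<in> W" if "x \<in> W" "y \<in> W" for x y r
    using that by (auto simp: W_def cinner_add cinner_diff cinner_scaleR)
  obtain w where w: "w \<in> W" "w \<noteq> 0"
  proof -
    obtain i where i: "i \<notin> S" using S by auto
    \<comment> \<open>Row \<open>i\<close> of \<open>M\<close> is zero, so \<open>M\<close> is
      singular; the other conditions on a kernel vector are exactly the orthogonality relations that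
      define \<open>W\<close>.\<close>
    define M :: "complex^'n^'n" where "M = (\<chi> k. if k \<in> S then (\<chi> j. cnj (u k $ j)) else 0)"
    have "\<nexists>N. M ** N = mat 1"
    proof
      assume "\<exists>N. M ** N = mat 1"
      then obtain N where "M ** N = mat 1" ..
      then have "(M ** N) $ i $ i = 1" by (simp add: mat_def)
      then show False using i by (simp add: matrix_matrix_mult_def M_def)
    qed
    then obtain x where x: "M *v x = 0" "x \<noteq> 0"
      by (metis matrix_left_invertible_ker matrix_left_right_inverse)
    have "cinner (u j) x = 0" if "j \<in> S" for j
    proof -
      have "cinner (u j) x = (M *v x) $ j"
        using that by (simp add: cinner_def M_def matrix_vector_mult_def)
      then show ?thesis using x by simp
    qed
    then show ?thesis using x that by (auto simp: W_def)
  qed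
  have "closed W"
  proof -
    have "W = (\<Inter>j\<in>S. {x. cinner (u j) x = 0})" by (auto simp: W_def)
    moreover have "closed {x. cinner (u j) x = 0}" for j
      by (intro closed_Collect_eq continuous_intros)
    ultimately show ?thesis by auto
  qed
  then have "compact (sphere 0 1 \<inter> W)" by (intro compact_Int_closed) auto
  moreover have "(1 / norm w) *\<^sub>R w \<in> sphere 0 1 \<inter> W" using w W_lin by auto
  then have "sphere 0 1 \<inter> W \<noteq> {}" by blast
  moreover have "continuous_on (sphere 0 1 \<inter> W) (\<lambda>y. y \<bullet> (H *v y))"
    by (intro continuous_intros linear_continuous_on) (simp add: linear_linear)
  ultimately obtain x where x: "x \<in> sphere 0 1 \<inter> W"
    and max: "\<And>y. y \<in> sphere 0 1 \<inter> W \<Longrightarrow> y \<bullet> (H *v y) \<le> x \<bullet> (H *v x)"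
    using continuous_attains_sup[of "sphere 0 1 \<inter> W" "\<lambda>y. y \<bullet> (H *v y)"] by blast
  define r where "r = x \<bullet> (H *v x)"
  \<comment> \<open>\<open>z\<close> is the residual of the eigenvalue equation and stays in
    \<open>W\<close>. The form \<open>g\<close> is nonnegative on \<open>W\<close> and zero at
    \<open>x\<close>, so moving from \<open>x\<close> in the direction \<open>z\<close> forces the
    linear coefficient \<open>2 * (z \<bullet> z)\<close> to vanish.\<close>
  define z where "z = r *\<^sub>R x - H *v x"
  define g where "g y = y \<bullet> (r *\<^sub>R y - H *v y)" for y
  have xx: "x \<bullet> x = 1" using x by (simp add: dot_square_norm)
  have g: "0 \<le> g y" if "y \<in> W" for y
  proof (cases "y = 0")
    case False
    have "((1 / norm y) *\<^sub>R y) \<bullet> (H *v ((1 / norm y) *\<^sub>R y)) \<le> r"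
      unfolding r_def using that False W_lin by (intro max) auto
    then have "(y \<bullet> (H *v y)) / (norm y)\<^sup>2 \<le> r"
      by (simp add: linear_cmul[OF matrix_vector_mul_linear] power2_eq_square)
    then have "y \<bullet> (H *v y) \<le> r * (norm y)\<^sup>2"
      using False by (simp add: field_simps)
    then show ?thesis by (simp add: g_def inner_diff_right dot_square_norm)
  qed (simp add: g_def)
  have zW: "z \<in> W" unfolding z_def using x HW W_lin by auto
  have sym: "a \<bullet> (H *v b) = b \<bullet> (H *v a)" for a b
    using H by (metis inner_conj_transpose hermitian_iff inner_commute)
  have "0 \<le> t * (2 * (z \<bullet> z)) + t\<^sup>2 * g z" for t
  proof -
    have "0 \<le> g (x + t *\<^sub>R z)"
      using g W_lin x zW by auto
    also have "\<dots> = g x + t * (2 * (z \<bullet> (r *\<^sub>R x - H *v x))) + t\<^sup>2 * g z"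
      unfolding g_def using sym[of x z]
      by (simp add: matrix_vector_right_distrib linear_cmul[OF matrix_vector_mul_linear]
          inner_add_left inner_add_right inner_diff_right inner_commute[of x z] power2_eq_square)
        (simp add: algebra_simps)
    also have "g x = 0" by (simp add: g_def r_def inner_diff_right xx)
    finally show ?thesis by (simp add: z_def)
  qed
  then have "2 * (z \<bullet> z) = 0" by (rule linear_coeff_zero)
  then have "H *v x = r *\<^sub>R x" by (simp add: z_def)
  then show ?thesis using that[of x r] x by (auto simp: W_def)
qed

definition diag_mat :: "('n \<Rightarrow> 'a) \<Rightarrow> 'a::zero^'n^'n" where
  "diag_mat d = (\<chi> i j. if i = j then d i else 0)"

lemma matrix_mult_diag_mat: "(M ** diag_mat d) $ i $ j = M $ i $ j * d j"
  by (simp add: matrix_matrix_mult_def diag_mat_def if_distrib[of "\<lambda>x. _ * x"] cong: if_cong)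

lemma diag_mat_mult: "diag_mat d ** diag_mat e = diag_mat (\<lambda>i. d i * e i)"
  by (auto simp: vec_eq_iff matrix_mult_diag_mat) (auto simp: diag_mat_def)

lemma conj_transpose_diag_mat [simp]:
  "conj_transpose (diag_mat (\<lambda>i. complex_of_real (d i))) = diag_mat (\<lambda>i. complex_of_real (d i))"
  by (simp add: vec_eq_iff diag_mat_def)

text \<open>An orthonormal family of eigenvectors is grown by one vector at a time, by induction
  over subsets of the index type; the family indexed by all of \<open>UNIV\<close> supplies the
  columns of \<open>U\<close>.\<close>

lemma hermitian_spectral:
  fixes H :: "complex^'n^'n"
  assumes H: "H \<in> hermitian_mats"
  obtains U :: "complex^'n^'n" and d :: "'n \<Rightarrow> real" where "conj_transpose U ** U = mat 1" "U ** conj_transpose U = mat 1"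
    "H = U ** diag_mat (\<lambda>i. complex_of_real (d i)) ** conj_transpose U"
proof -
  have "\<exists>u d. (\<forall>i\<in>S. H *v u i = d i *\<^sub>R u i) \<and>
      (\<forall>i\<in>S. \<forall>j\<in>S. cinner (u i) (u j) = (if i = j then 1 else 0))" for S :: "'n set"
    using finite[of S]
  proof (induction S)
    case (insert k S)
    then obtain u d where eig: "\<And>i. i \<in> S \<Longrightarrow> H *v u i = d i *\<^sub>R u i"
      and on: "\<And>i j. i \<in> S \<Longrightarrow> j \<in> S \<Longrightarrow> cinner (u i) (u j) = (if i = j then 1 else 0)"
      by blast
    have "S \<noteq> UNIV" using insert by auto
    then obtain x r where x: "norm x = 1" "H *v x = r *\<^sub>R x" "\<And>j. j \<in> S \<Longrightarrow> cinner (u j) x = 0"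
      using hermitian_eigenvector_orthogonal[of H S u d] H eig by metis
    have "cinner x (u j) = 0" if "j \<in> S" for j
      using x(3)[OF that] by (subst cinner_commute) simp
    moreover have "cinner x x = 1" using x by (simp add: cinner_self)
    ultimately show ?case
      using x eig on insert(2)
      by (intro exI[of _ "u(k := x)"] exI[of _ "d(k := r)"]) auto
  qed auto
  from this[of UNIV] obtain u :: "'n \<Rightarrow> complex^'n" and d where eig: "\<And>i. H *v u i = d i *\<^sub>R u i"
    and on: "\<And>i j. cinner (u i) (u j) = (if i = j then 1 else 0)"
    by auto
  define U :: "complex^'n^'n" where "U = (\<chi> i j. u j $ i)"
  have U: "conj_transpose U ** U = mat 1"
    using on by (simp add: vec_eq_iff matrix_matrix_mult_def U_def mat_def cinner_def)
  then have U': "U ** conj_transpose U = mat 1"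
    using matrix_left_right_inverse by blast
  have "(H ** U) $ i $ j = (U ** diag_mat (\<lambda>i. complex_of_real (d i))) $ i $ j" for i j
  proof -
    have "(H ** U) $ i $ j = (H *v u j) $ i"
      by (simp add: matrix_matrix_mult_def matrix_vector_mult_def U_def)
    also have "\<dots> = d j *\<^sub>R u j $ i"
      by (simp only: eig vector_scaleR_component)
    finally show ?thesis
      by (simp add: matrix_mult_diag_mat U_def scaleR_conv_of_real[of _ "_ $ _"] mult.commute)
  qed
  then have "H ** U = U ** diag_mat (\<lambda>i. complex_of_real (d i))"
    by (simp add: vec_eq_iff)
  then have "H = U ** diag_mat (\<lambda>i. complex_of_real (d i)) ** conj_transpose U"
    by (metis U' matrix_mul_assoc matrix_mul_rid)
  then show ?thesis using that U U' by blast
qed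

section \<open>The Frobenius norm\<close>

lemma gram_diagonal:
  "(conj_transpose B ** B) $ i $ i = of_real ((norm (column i B))\<^sup>2)"
proof -
  have "(conj_transpose B ** B) $ i $ i = cinner (column i B) (column i B)"
    by (simp add: matrix_matrix_mult_def cinner_def column_def)
  then show ?thesis by (simp only: cinner_self)
qed

lemma trace_gram: "trace (conj_transpose B ** B) = of_real (\<Sum>i\<in>UNIV. (norm (column i B))\<^sup>2)"
  by (simp only: trace_def gram_diagonal of_real_sum)

lemma norm_matrix_sq_rows: "(norm M)\<^sup>2 = (\<Sum>i\<in>UNIV. (norm (M $ i))\<^sup>2)"
  for M :: "complex^'m^'n"
  by (simp add: norm_vec_def L2_set_def sum_nonneg)

lemma norm_matrix_sq_columns: "(norm M)\<^sup>2 = (\<Sum>i\<in>UNIV. (norm (column i M))\<^sup>2)"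
  for M :: "complex^'m^'n"
  by (simp add: norm_vec_def L2_set_def sum_nonneg column_def) (rule sum.swap)

lemma norm_matrix_sq_trace: "(norm M)\<^sup>2 = Re (trace (conj_transpose M ** M))"
  for M :: "complex^'m^'n"
  by (simp add: trace_gram norm_matrix_sq_columns del: of_real_sum)

lemma norm_conj_transpose [simp]: "norm (conj_transpose M) = norm M"
  for M :: "complex^'m^'n"
  by (simp add: norm_vec_def L2_set_def sum_nonneg) (rule sum.swap)

lemma cmod_cinner_le: "cmod (cinner x y) \<le> norm x * norm y"
proof -
  have "cmod (cinner x y) \<le> (\<Sum>i\<in>UNIV. cmod (x $ i) * cmod (y $ i))"
    unfolding cinner_def by (rule order_trans[OF norm_sum]) (simp add: norm_mult)
  also have "\<dots> \<le> norm x * norm y"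
    unfolding norm_vec_def using L2_set_mult_ineq[of "\<lambda>i. cmod (x $ i)" "\<lambda>i. cmod (y $ i)" UNIV]
    by simp
  finally show ?thesis .
qed

text \<open>Each entry of the product pairs a column of \<open>M\<close> with a column of
  \<open>N\<close>, so Cauchy-Schwarz entry by entry suffices. With the adjoint on the left it
  applies directly to the blocks of a Gram matrix.\<close>

lemma norm_conj_transpose_mult_le: "norm (conj_transpose M ** N) \<le> norm M * norm N"
  for M :: "complex^'m^'n" and N :: "complex^'p^'n"
proof (rule power2_le_imp_le)
  have "(conj_transpose M ** N) $ i $ j = cinner (column i M) (column j N)" for i j
    by (simp add: matrix_matrix_mult_def cinner_def column_def)
  then have "(norm (conj_transpose M ** N))\<^sup>2
      = (\<Sum>i\<in>UNIV. \<Sum>j\<in>UNIV. (cmod (cinner (column i M) (column j N)))\<^sup>2)"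
    by (simp add: norm_matrix_sq_rows) (simp add: norm_vec_def L2_set_def sum_nonneg)
  also have "\<dots> \<le> (\<Sum>i\<in>UNIV. \<Sum>j\<in>UNIV. (norm (column i M) * norm (column j N))\<^sup>2)"
    by (intro sum_mono power_mono cmod_cinner_le) auto
  also have "\<dots> = (norm M * norm N)\<^sup>2"
    by (simp add: power_mult_distrib norm_matrix_sq_columns sum_product)
  finally show "(norm (conj_transpose M ** N))\<^sup>2 \<le> (norm M * norm N)\<^sup>2" .
qed auto

section \<open>Singular values and Schatten norms\<close>

lemma map_matrix_const_poly_mult:
  "map_matrix (\<lambda>c. [:c:]) (M ** N) = map_matrix (\<lambda>c. [:c:]) M ** map_matrix (\<lambda>c. [:c:]) N"
  for M N :: "'a::comm_ring_1 ^ _ ^ _"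
  by (simp add: vec_eq_iff matrix_matrix_mult_def mult.commute flip: sum_to_poly)

text \<open>The embedding \<open>c\<close> of constants respects products and
  \<open>mat [:0, 1:]\<close> is central, so conjugation by \<open>c U\<close> carries one
  characteristic matrix to the other, and determinants multiply.\<close>

lemma char_polynomial_similar:
  fixes U U' M :: "complex^'n^'n"
  assumes "U ** U' = mat 1"
  shows "char_polynomial (U ** M ** U') = char_polynomial M"
proof -
  define c :: "complex^'n^'n \<Rightarrow> complex poly^'n^'n" where "c = map_matrix (\<lambda>x. [:x:])"
  have c_mult: "c (M ** N) = c M ** c N" for M N
    by (simp add: c_def map_matrix_const_poly_mult)
  have "c (mat 1) = mat 1"
    by (simp add: c_def vec_eq_iff mat_def one_pCons)
  then have one: "c U ** c U' = mat 1"
    using assms by (simp flip: c_mult)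
  have comm: "N ** mat [:0, 1:] = mat [:0, 1:] ** N" for N :: "complex poly^'n^'n"
    by (simp add: vec_eq_iff matrix_matrix_mult_def mat_def if_distrib if_distribR sum.delta cong: if_cong)
  have "c U ** (mat [:0, 1:] - c M) ** c U' = mat [:0, 1:] - c (U ** M ** U')"
    by (simp add: matrix_diff_ldistrib matrix_diff_rdistrib comm c_mult)
      (simp add: one flip: matrix_mul_assoc)
  then have "char_polynomial (U ** M ** U') = det (c U) * det (mat [:0, 1:] - c M) * det (c U')"
    unfolding char_polynomial_def c_def[symmetric] by (metis det_mul)
  also have "\<dots> = det (c U ** c U') * det (mat [:0, 1:] - c M)"
    by (simp add: det_mul)
  also have "\<dots> = det (mat [:0, 1:] - c M)"
    by (simp add: one)
  finally show ?thesis
    by (simp only: char_polynomial_def c_def)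
qed

lemma char_polynomial_diag_mat: "char_polynomial (diag_mat d) = (\<Prod>i\<in>UNIV. [:- d i, 1:])"
  unfolding char_polynomial_def
  by (subst det_diagonal) (auto simp: mat_def diag_mat_def)

text \<open>The matrix H^* H is unitarily similar to the diagonal matrix of the squares of
  \<open>d i\<close>, so its characteristic polynomial splits into linear factors and its roots can
  be read off with multiplicity.\<close>

lemma singular_values_hermitian:
  fixes H U :: "complex^'n^'n"
  assumes "U ** conj_transpose U = mat 1" "conj_transpose U ** U = mat 1"
    and H: "H = U ** diag_mat (\<lambda>i. complex_of_real (d i)) ** conj_transpose U"
  shows "singular_values H = image_mset (\<lambda>i. \<bar>d i\<bar>) (mset_set UNIV)"
proof -
  define D where "D = diag_mat (\<lambda>i. complex_of_real (d i))"
  have "conj_transpose H ** H = U ** D ** (conj_transpose U ** U) ** D ** conj_transpose U"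
    by (simp add: H conj_transpose_mult D_def flip: matrix_mul_assoc)
  also have "\<dots> = U ** diag_mat (\<lambda>i. complex_of_real ((d i)\<^sup>2)) ** conj_transpose U"
    by (simp add: assms(2) D_def power2_eq_square flip: diag_mat_mult) (simp add: matrix_mul_assoc)
  finally have "char_polynomial (conj_transpose H ** H) = (\<Prod>i\<in>UNIV. [:- complex_of_real ((d i)\<^sup>2), 1:])"
    by (simp only: char_polynomial_similar[OF assms(1)] char_polynomial_diag_mat)
  then have "proots (char_polynomial (conj_transpose H ** H))
      = (\<Sum>i\<in>UNIV. {#complex_of_real ((d i)\<^sup>2)#})"
    by (simp add: proots_prod del: of_real_power)
  also have "\<dots> = image_mset (\<lambda>i. complex_of_real ((d i)\<^sup>2)) (mset_set UNIV)"
    by (simp add: sum_unfold_sum_mset del: of_real_power)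
  finally show ?thesis
    by (simp add: singular_values_def image_mset.compositionality comp_def del: of_real_power)
qed

lemma schatten_norm_hermitian:
  fixes H U :: "complex^'n^'n"
  assumes "U ** conj_transpose U = mat 1" "conj_transpose U ** U = mat 1"
    and H: "H = U ** diag_mat (\<lambda>i. complex_of_real (d i)) ** conj_transpose U"
  shows "schatten_norm s H = (\<Sum>i\<in>UNIV. \<bar>d i\<bar> powr s) powr (1 / s)"
  by (simp add: schatten_norm_def singular_values_hermitian[OF assms] image_mset.compositionality
      comp_def sum_unfold_sum_mset)

lemma schatten_norm_nonneg [simp]: "0 \<le> schatten_norm s M"
  by (simp add: schatten_norm_def)

lemma schatten_norm_zero [simp]: "schatten_norm s (0 :: complex^'n^'n) = 0"
proof -
  have "diag_mat (\<lambda>i. complex_of_real 0) = (0 :: complex^'n^'n)"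
    by (simp add: diag_mat_def vec_eq_iff)
  then have "0 = mat 1 ** diag_mat (\<lambda>i. complex_of_real 0) ** conj_transpose (mat 1 :: complex^'n^'n)"
    by simp
  from schatten_norm_hermitian[OF _ _ this] show ?thesis by simp
qed

text \<open>Both sides are the Euclidean norm of the eigenvalue vector, by cyclicity of the trace.
  This passes from the norm in the definition of stability to \<open>norm\<close>, in which all
  estimates are made.\<close>

lemma schatten_norm_2_hermitian:
  fixes H :: "complex^'n^'n"
  assumes "H \<in> hermitian_mats"
  shows "schatten_norm 2 H = norm H"
proof -
  obtain U :: "complex^'n^'n" and d where U: "conj_transpose U ** U = mat 1" "U ** conj_transpose U = mat 1"
    and H: "H = U ** diag_mat (\<lambda>i. complex_of_real (d i)) ** conj_transpose U"
    using hermitian_spectral[OF assms] .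
  define D where "D = diag_mat (\<lambda>i. complex_of_real (d i))"
  have "conj_transpose H ** H = U ** (D ** (conj_transpose U ** U) ** D ** conj_transpose U)"
    by (simp add: H conj_transpose_mult D_def flip: matrix_mul_assoc)
  then have "trace (conj_transpose H ** H) = trace (D ** D ** (conj_transpose U ** U))"
    by (simp only: trace_mul_sym[of U]) (simp add: U flip: matrix_mul_assoc)
  also have "\<dots> = of_real (\<Sum>i\<in>UNIV. (d i)\<^sup>2)"
    by (simp add: U D_def diag_mat_mult) (simp add: trace_def diag_mat_def power2_eq_square)
  finally have "(norm H)\<^sup>2 = (\<Sum>i\<in>UNIV. (d i)\<^sup>2)"
    by (simp add: norm_matrix_sq_trace del: of_real_sum)
  moreover have "schatten_norm 2 H = sqrt (\<Sum>i\<in>UNIV. (d i)\<^sup>2)"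
    by (simp add: schatten_norm_hermitian[OF U(2,1) H] powr_half_sqrt sum_nonneg)
  ultimately show ?thesis by (metis norm_ge_zero real_sqrt_unique)
qed

lemma trace_hermitian_diag:
  assumes "H = U ** diag_mat d ** conj_transpose U"
  shows "trace (Q ** H) = (\<Sum>i\<in>UNIV. (conj_transpose U ** Q ** U) $ i $ i * d i)"
proof -
  have "trace (Q ** H) = trace ((Q ** U ** diag_mat d) ** conj_transpose U)"
    by (simp add: assms matrix_mul_assoc)
  also have "\<dots> = trace ((conj_transpose U ** Q ** U) ** diag_mat d)"
    by (subst trace_mul_sym) (simp add: matrix_mul_assoc)
  finally show ?thesis
    by (simp add: trace_def matrix_mult_diag_mat)
qed

text \<open>An instance of the duality of trace norm and operator norm. In an eigenbasis of
  \<open>H\<close> the trace is the sum of the eigenvalues weighted by the diagonal of U^* Q U, and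
  these weights lie in [0, 1].\<close>

lemma trace_projector_le_schatten_norm_1:
  fixes H :: "complex^'n^'n"
  assumes H: "H \<in> hermitian_mats" and Q: "Q \<in> hermitian_mats" "Q ** Q = Q"
  shows "Re (trace (Q ** H)) \<le> schatten_norm 1 H"
proof -
  obtain U :: "complex^'n^'n" and d where U: "conj_transpose U ** U = mat 1" "U ** conj_transpose U = mat 1"
    and HU: "H = U ** diag_mat (\<lambda>i. complex_of_real (d i)) ** conj_transpose U"
    using hermitian_spectral[OF H] .
  define R where "R = mat 1 - Q"
  have Qh: "conj_transpose Q = Q" using Q by (simp add: hermitian_iff)
  have "conj_transpose U ** Q ** U = conj_transpose U ** (Q ** Q) ** U" using Q by simp
  also have "\<dots> = conj_transpose (Q ** U) ** (Q ** U)"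
    by (simp add: conj_transpose_mult Qh matrix_mul_assoc)
  finally have q: "conj_transpose U ** Q ** U = conj_transpose (Q ** U) ** (Q ** U)" .
  have "R ** R = R" and Rh: "conj_transpose R = R"
    using Q by (simp_all add: R_def matrix_diff_ldistrib matrix_diff_rdistrib conj_transpose_diff Qh)
  then have "conj_transpose U ** R ** U = conj_transpose U ** (R ** R) ** U" by simp
  also have "\<dots> = conj_transpose (R ** U) ** (R ** U)"
    by (simp add: conj_transpose_mult Rh matrix_mul_assoc)
  finally have r: "conj_transpose U ** R ** U = conj_transpose (R ** U) ** (R ** U)" .
  \<comment> \<open>On the diagonal this splits 1 into the squared column norms of
    \<open>Q ** U\<close> and \<open>R ** U\<close>, so neither exceeds 1.\<close>
  have "conj_transpose U ** Q ** U + conj_transpose U ** R ** U = mat 1"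
    by (simp add: R_def matrix_diff_ldistrib matrix_diff_rdistrib U)
  then have "(conj_transpose (Q ** U) ** (Q ** U)) $ i $ i
      + (conj_transpose (R ** U) ** (R ** U)) $ i $ i = (mat 1 :: complex^'n^'n) $ i $ i" for i
    by (metis q r vector_add_component)
  then have "complex_of_real ((norm (column i (Q ** U)))\<^sup>2 + (norm (column i (R ** U)))\<^sup>2) = of_real 1" for i
    by (simp only: gram_diagonal of_real_add) (simp add: mat_def)
  then have "(norm (column i (Q ** U)))\<^sup>2 + (norm (column i (R ** U)))\<^sup>2 = 1" for i
    by (simp only: of_real_eq_iff)
  then have le1: "(norm (column i (Q ** U)))\<^sup>2 \<le> 1" for i
    by (metis le_add_same_cancel1 zero_le_power2)
  have "Re (trace (Q ** H)) = (\<Sum>i\<in>UNIV. (norm (column i (Q ** U)))\<^sup>2 * d i)"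
    unfolding trace_hermitian_diag[OF HU] q gram_diagonal by simp
  also have "\<dots> \<le> (\<Sum>i\<in>UNIV. 1 * \<bar>d i\<bar>)"
    by (intro sum_mono order_trans[OF mult_left_mono mult_right_mono] le1) auto
  also have "\<dots> = schatten_norm 1 H"
    by (simp add: schatten_norm_hermitian[OF U(2,1) HU] sum_nonneg)
  finally show ?thesis .
qed

lemma psd_eigenvalue_nonneg:
  assumes V: "V \<in> psd_mats" and U: "conj_transpose U ** U = mat 1"
    and VU: "V = U ** diag_mat (\<lambda>i. complex_of_real (d i)) ** conj_transpose U"
  shows "0 \<le> d i"
proof -
  define x where "x = column i U"
  have "V ** U = U ** diag_mat (\<lambda>i. complex_of_real (d i))"
    by (simp add: VU U flip: matrix_mul_assoc)
  moreover have "(V *v x) $ k = (V ** U) $ k $ i" for k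
    by (simp add: x_def column_def matrix_matrix_mult_def matrix_vector_mult_def)
  ultimately have "V *v x = d i *\<^sub>R x"
    by (simp add: vec_eq_iff matrix_mult_diag_mat x_def column_def
        scaleR_conv_of_real[of _ "_ $ _"] mult.commute)
  moreover have "complex_of_real ((norm x)\<^sup>2) = of_real 1"
    unfolding x_def gram_diagonal[symmetric] U by (simp add: mat_def)
  then have "(norm x)\<^sup>2 = 1" by (simp only: of_real_eq_iff)
  ultimately have "x \<bullet> (V *v x) = d i"
    by (simp add: dot_square_norm)
  then show ?thesis using V unfolding psd_iff by metis
qed

text \<open>With such a factor, diagonal entries of \<open>V\<close> become squared column norms of
  \<open>B\<close>, and compressions of \<open>V\<close> by projectors become products of
  \<open>B ** P\<close> and \<open>B ** Q\<close>.\<close>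

lemma psd_sqrt:
  fixes V :: "complex^'n^'n"
  assumes "V \<in> psd_mats"
  obtains B :: "complex^'n^'n" where "V = conj_transpose B ** B"
proof -
  have "V \<in> hermitian_mats" using assms by (simp add: psd_iff)
  then obtain U :: "complex^'n^'n" and d where U: "conj_transpose U ** U = mat 1"
    and V: "V = U ** diag_mat (\<lambda>i. complex_of_real (d i)) ** conj_transpose U"
    using hermitian_spectral by metis
  define E where "E = diag_mat (\<lambda>i. complex_of_real (sqrt (d i)))"
  have "E ** E = diag_mat (\<lambda>i. complex_of_real (d i))"
    using psd_eigenvalue_nonneg[OF assms U V] unfolding E_def diag_mat_mult
    by (simp flip: of_real_mult)
  moreover have "conj_transpose E = E" by (simp add: E_def)
  ultimately have "V = conj_transpose (E ** conj_transpose U) ** (E ** conj_transpose U)"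
    by (simp add: V conj_transpose_mult matrix_mul_assoc) (simp flip: matrix_mul_assoc)
  then show ?thesis using that by blast
qed

lemma schatten_norm_1_psd:
  fixes V :: "complex^'n^'n"
  assumes "V \<in> psd_mats"
  shows "schatten_norm 1 V = Re (trace V)"
proof -
  have "V \<in> hermitian_mats" using assms by (simp add: psd_iff)
  then obtain U :: "complex^'n^'n" and d where U: "conj_transpose U ** U = mat 1" "U ** conj_transpose U = mat 1"
    and V: "V = U ** diag_mat (\<lambda>i. complex_of_real (d i)) ** conj_transpose U"
    using hermitian_spectral by metis
  have "Re (trace (mat 1 ** V)) = (\<Sum>i\<in>UNIV. d i)"
    unfolding trace_hermitian_diag[OF V] by (simp add: U) (simp add: mat_def)
  then show ?thesis
    using psd_eigenvalue_nonneg[OF assms U(1) V]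
    by (simp add: schatten_norm_hermitian[OF U(2,1) V] sum_nonneg)
qed

section \<open>The Moore-Penrose pseudoinverse\<close>

text \<open>\<open>M ** X\<close> and \<open>M ** Y\<close> are Hermitian and each fixes the range
  of the other, so taking adjoints identifies them; likewise \<open>X ** M\<close> and
  \<open>Y ** M\<close>. Then X = X M X = Y M Y = Y.\<close>

lemma is_pinv_unique:
  assumes X: "is_pinv M X" and Y: "is_pinv M Y"
  shows "X = Y"
proof -
  have "M ** X = conj_transpose (M ** Y ** M ** X)"
    using X Y by (simp add: is_pinv_def)
  also have "\<dots> = conj_transpose (M ** X) ** conj_transpose (M ** Y)"
    by (simp add: matrix_mul_assoc flip: conj_transpose_mult)
  also have "\<dots> = M ** Y"
    using X Y by (simp add: is_pinv_def matrix_mul_assoc)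
  finally have 1: "M ** X = M ** Y" .
  have "X ** M = conj_transpose (X ** (M ** Y ** M))"
    using X Y by (simp add: is_pinv_def)
  also have "\<dots> = conj_transpose (Y ** M) ** conj_transpose (X ** M)"
    by (simp add: matrix_mul_assoc flip: conj_transpose_mult)
  also have "\<dots> = Y ** (M ** X ** M)"
    using X Y by (simp add: is_pinv_def flip: matrix_mul_assoc)
  also have "\<dots> = Y ** M"
    using X by (metis is_pinv_def)
  finally have 2: "X ** M = Y ** M" .
  have "X = X ** M ** X" using X by (simp add: is_pinv_def)
  also have "\<dots> = Y ** M ** X" by (simp add: 2)
  also have "\<dots> = Y ** M ** Y" using 1 by (simp flip: matrix_mul_assoc)
  also have "\<dots> = Y" using Y by (simp add: is_pinv_def)
  finally show ?thesis .
qed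

lemma gram_eq_0_iff: "conj_transpose M ** M = 0 \<longleftrightarrow> M = 0"
proof
  assume "conj_transpose M ** M = 0"
  then have "(norm M)\<^sup>2 = 0" by (simp add: norm_matrix_sq_trace trace_def)
  then show "M = 0" by simp
qed simp

text \<open>Inverting the nonzero eigenvalues of \<open>N = M\<^sup>* M\<close> gives \<open>K\<close>, and \<open>K M\<^sup>*\<close> is the pseudoinverse.\<close>
lemma is_pinv_exists: "\<exists>X. is_pinv M X"
  for M :: "complex^'n^'m"
proof -
  define N where "N = conj_transpose M ** M"
  obtain U :: "complex^'n^'n" and d where U: "conj_transpose U ** U = mat 1" "U ** conj_transpose U = mat 1"
    and N: "N = U ** diag_mat (\<lambda>i. complex_of_real (d i)) ** conj_transpose U"
    using hermitian_spectral[of N] hermitian_gram unfolding N_def by metis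
  define c where "c e = U ** diag_mat (\<lambda>i. complex_of_real (e i)) ** conj_transpose U" for e
  define K where "K = c (\<lambda>i. inverse (d i))"
  have c_mult: "c e ** c f = c (\<lambda>i. e i * f i)" for e f
  proof -
    have "c e ** c f = U ** diag_mat (\<lambda>i. complex_of_real (e i)) ** (conj_transpose U ** U)
        ** diag_mat (\<lambda>i. complex_of_real (f i)) ** conj_transpose U"
      by (simp add: c_def matrix_mul_assoc)
    also have "\<dots> = U ** (diag_mat (\<lambda>i. complex_of_real (e i))
        ** diag_mat (\<lambda>i. complex_of_real (f i))) ** conj_transpose U"
      by (simp only: U matrix_mul_rid matrix_mul_assoc)
    finally show ?thesis by (simp add: c_def diag_mat_mult)
  qed
  have ch: "conj_transpose (c e) = c e" for e
    by (simp add: c_def conj_transpose_mult matrix_mul_assoc)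
  have Nc: "N = c d" by (simp add: N c_def)
  \<comment> \<open>The convention \<open>inverse 0 = 0\<close> makes both identities hold at the
    zero eigenvalues too.\<close>
  have "(\<lambda>i. d i * (inverse (d i) * d i)) = d" "(\<lambda>i. inverse (d i) * d i * inverse (d i)) = (\<lambda>i. inverse (d i))"
    by (auto simp: fun_eq_iff field_simps)
  then have NKN: "N ** (K ** N) = N" and KNK: "K ** N ** K = K" and KN: "conj_transpose (K ** N) = K ** N"
    by (simp_all add: Nc K_def c_mult ch)
  have Kh: "conj_transpose K = K" by (simp add: K_def ch)
  define X where "X = K ** conj_transpose M"
  have XM: "X ** M = K ** N" by (simp add: X_def N_def matrix_mul_assoc)
  \<comment> \<open>The equation M X M = M says \<open>Z = 0\<close>. Its Gram matrix contains the
    factor \<open>N ** (mat 1 - K ** N)\<close>, which vanishes.\<close>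
  define Z where "Z = M ** (mat 1 - K ** N)"
  have "conj_transpose Z ** Z = conj_transpose (mat 1 - K ** N) ** (N ** (mat 1 - K ** N))"
    by (simp add: Z_def conj_transpose_mult N_def matrix_mul_assoc)
  also have "\<dots> = 0" by (simp add: matrix_diff_ldistrib NKN)
  finally have "Z = 0" by (simp add: gram_eq_0_iff)
  then have "M ** (X ** M) = M"
    by (simp add: Z_def XM matrix_diff_ldistrib)
  moreover have "X ** M ** X = X"
    unfolding XM by (simp add: X_def matrix_mul_assoc KNK)
  moreover have "conj_transpose (M ** X) = M ** X"
    by (simp add: X_def conj_transpose_mult Kh matrix_mul_assoc)
  moreover have "conj_transpose (X ** M) = X ** M"
    by (simp add: XM KN)
  ultimately show ?thesis
    by (auto simp: is_pinv_def matrix_mul_assoc)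
qed

lemma is_pinv_pinv: "is_pinv M (pinv M)"
  unfolding pinv_def using is_pinv_exists is_pinv_unique by (metis theI)

section \<open>PhaseCut and Weak PhaseLift\<close>

lemma norm_projector_mult_vec_le:
  assumes "Q \<in> hermitian_mats" "Q ** Q = Q"
  shows "norm (Q *v z) \<le> norm z"
proof -
  have "(norm (Q *v z))\<^sup>2 = z \<bullet> (Q *v (Q *v z))"
    using assms(1) by (simp add: inner_conj_transpose[of z] hermitian_iff power2_norm_eq_inner)
  also have "\<dots> = z \<bullet> (Q *v z)" by (simp add: matrix_vector_mul_assoc assms)
  also have "\<dots> \<le> norm z * norm (Q *v z)" by (rule norm_cauchy_schwarz)
  finally have "norm (Q *v z) = 0 \<or> norm (Q *v z) \<le> norm z"
    by (simp only: power2_eq_square mult_le_cancel_right) auto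
  then show ?thesis by auto
qed

lemma norm_mult_projector_sq:
  fixes B :: "complex^'n^'k"
  assumes "P \<in> hermitian_mats" "P ** P = P"
  shows "(norm (B ** P))\<^sup>2 = Re (trace (P ** (conj_transpose B ** B)))"
proof -
  have "(norm (B ** P))\<^sup>2 = Re (trace (P ** conj_transpose B ** B ** P))"
    using assms by (simp add: norm_matrix_sq_trace conj_transpose_mult hermitian_iff matrix_mul_assoc)
  also have "\<dots> = Re (trace (P ** (P ** conj_transpose B ** B)))"
    by (subst trace_mul_sym) simp
  finally show ?thesis by (simp add: matrix_mul_assoc assms)
qed

lemma norm_mult_projector_complement:
  fixes B :: "complex^'n^'k"
  assumes "P \<in> hermitian_mats" "P ** P = P"
  shows "(norm (B ** P))\<^sup>2 + (norm (B ** (mat 1 - P)))\<^sup>2 = (norm B)\<^sup>2"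
proof -
  have "mat 1 - P \<in> hermitian_mats" "(mat 1 - P) ** (mat 1 - P) = mat 1 - P"
    using assms by (simp_all add: hermitian_iff conj_transpose_diff matrix_diff_ldistrib matrix_diff_rdistrib)
  then show ?thesis
    using assms
    by (simp add: norm_mult_projector_sq matrix_diff_rdistrib trace_sub norm_matrix_sq_trace[of B])
qed

text \<open>Written as a matrix with a single row, \<open>v\<close> makes \<open>rank_one v\<close>
  a Gram matrix, so results on Gram matrices with any number of rows cover the rank-one competitor
  as well.\<close>

definition row_mat :: "complex^'n \<Rightarrow> complex^'n^1" where
  "row_mat v = (\<chi> i j. cnj (v $ j))"

lemma gram_row_mat: "conj_transpose (row_mat v) ** row_mat v = rank_one v"
  by (simp add: vec_eq_iff matrix_matrix_mult_def row_mat_def rank_one_def)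

lemma rank_one_psd: "rank_one v \<in> psd_mats"
  using psd_gram[of "row_mat v"] by (simp add: gram_row_mat)

lemma row_mat_mult:
  assumes "Q \<in> hermitian_mats"
  shows "row_mat v ** Q = row_mat (Q *v v)"
proof -
  have "Q $ i $ j = cnj (Q $ j $ i)" for i j
    using assms by (metis hermitian_iff conj_transpose_nth)
  then have "cnj (v $ k) * Q $ k $ j = cnj (Q $ j $ k * v $ k)" for k j
    by (metis complex_cnj_mult mult.commute)
  then show ?thesis
    by (simp only: vec_eq_iff matrix_matrix_mult_def matrix_vector_mult_def row_mat_def
        vec_lambda_beta cnj_sum simp_thms)
qed

lemma norm_row_mat [simp]: "norm (row_mat v) = norm v"
  by (simp add: norm_vec_def row_mat_def L2_set_def sum_nonneg)

lemma rank_one_in_set_H: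
  assumes "\<And>i. cmod (v $ i) = \<bar>b $ i\<bar>"
  shows "rank_one v \<in> set_H b"
  using rank_one_psd[of v] assms
  by (simp add: set_H_def psd_iff rank_one_def flip: complex_norm_square)

lemma rank_one_0 [simp]: "rank_one 0 = 0"
  by (simp add: rank_one_def vec_eq_iff)

lemma rank_one_eq_0_iff: "rank_one v = 0 \<longleftrightarrow> v = 0"
proof
  assume "rank_one v = 0"
  then have "rank_one v $ i $ i = 0" for i by simp
  then show "v = 0" by (simp add: rank_one_def vec_eq_iff)
qed simp

lemma norm_entrywise_cmod [simp]: "norm (entrywise_cmod v) = norm v"
  by (simp add: norm_vec_def entrywise_cmod_def)

lemma stable_at_iff:
  "stable_at minimizer A C x0 \<longleftrightarrow>
    (\<exists>d>0. \<forall>e. norm e < d \<longrightarrow> (\<forall>V. minimizer (entrywise_cmod (A *v x0) + e) V \<longrightarrow>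
        schatten_norm 2 (V - rank_one (A *v x0)) \<le> C * norm (A *v x0) * norm e))"
  unfolding stable_at_def eventually_nhds_metric by (simp only: dist_norm diff_0_right)

section \<open>The range projector of \<open>A\<close>, the objectives and the transfer of
  stability\<close>

context
  fixes A :: "complex^'m^'n" and P Q :: "complex^'n^'n"
  defines "P \<equiv> A ** pinv A" and "Q \<equiv> mat 1 - P"
begin

lemma range_projector: "P \<in> hermitian_mats" "P ** P = P"
  using is_pinv_pinv[of A] by (simp_all add: is_pinv_def P_def hermitian_iff matrix_mul_assoc)

lemma kernel_projector: "Q \<in> hermitian_mats" "Q ** Q = Q" "Q ** P = 0" "P ** Q = 0" "Q ** A = 0"
  using range_projector is_pinv_pinv[of A]
  by (simp_all add: Q_def hermitian_iff conj_transpose_diff matrix_diff_ldistrib matrix_diff_rdistrib)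
    (simp add: P_def is_pinv_def)

lemma set_F_iff: "V \<in> set_F A \<longleftrightarrow> V \<in> hermitian_mats \<and> Q ** V ** Q = 0"
  by (simp add: set_F_def Q_def P_def)

lemma trace_kernel_projector: "trace (Q ** V ** Q) = trace (Q ** V)"
  by (subst trace_mul_sym) (simp add: matrix_mul_assoc kernel_projector)

text \<open>Lower bound: \<open>trace (Q ** W)\<close> vanishes on \<open>set_F A\<close>, so trace
  duality bounds every distance below by \<open>trace (Q ** V)\<close>. Upper bound:
  \<open>V - Q ** V ** Q\<close> lies in \<open>set_F A\<close>, and the difference Q V Q is
  positive semidefinite, so its trace norm is its trace.\<close>

lemma schatten_dist_set_F:
  fixes B :: "complex^'n^'k"
  shows "schatten_dist 1 (conj_transpose B ** B) (set_F A) = (norm (B ** Q))\<^sup>2"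
proof (rule antisym)
  define V where "V = conj_transpose B ** B"
  have V: "V \<in> hermitian_mats" by (simp add: V_def hermitian_gram)
  have tr: "(norm (B ** Q))\<^sup>2 = Re (trace (Q ** V))"
    by (simp add: norm_mult_projector_sq kernel_projector V_def)
  have "0 \<in> set_F A" by (simp add: set_F_iff hermitian_iff)
  then have "set_F A \<noteq> {}" by blast
  then have "Re (trace (Q ** V)) \<le> schatten_dist 1 V (set_F A)"
    unfolding schatten_dist_def
  proof (rule cINF_greatest)
    fix W assume W: "W \<in> set_F A"
    then have "trace (Q ** W) = 0"
      unfolding trace_kernel_projector[symmetric] by (simp add: set_F_iff trace_def)
    then have "Re (trace (Q ** V)) = Re (trace (Q ** (V - W)))"
      by (simp add: matrix_diff_ldistrib trace_sub)
    also have "\<dots> \<le> schatten_norm 1 (V - W)"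
      using V W by (intro trace_projector_le_schatten_norm_1 kernel_projector hermitian_diff)
        (auto simp: set_F_iff)
    finally show "Re (trace (Q ** V)) \<le> schatten_norm 1 (V - W)" .
  qed
  then show "(norm (B ** Q))\<^sup>2 \<le> schatten_dist 1 (conj_transpose B ** B) (set_F A)"
    by (simp add: tr V_def)
  have QVQ: "Q ** V ** Q = conj_transpose (B ** Q) ** (B ** Q)"
    using kernel_projector(1) by (simp add: V_def conj_transpose_mult hermitian_iff matrix_mul_assoc)
  have "Q ** (V - Q ** V ** Q) ** Q = Q ** V ** Q - (Q ** Q) ** V ** (Q ** Q)"
    by (simp add: matrix_diff_ldistrib matrix_diff_rdistrib matrix_mul_assoc)
  then have "V - Q ** V ** Q \<in> set_F A"
    unfolding set_F_iff using V
    by (simp add: kernel_projector(2) hermitian_diff hermitian_gram QVQ)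
  then have "schatten_dist 1 V (set_F A) \<le> schatten_norm 1 (V - (V - Q ** V ** Q))"
    unfolding schatten_dist_def by (intro cINF_lower bdd_belowI2[of _ 0]) auto
  also have "\<dots> = Re (trace (Q ** V ** Q))"
    using psd_gram[of "B ** Q"] by (simp add: schatten_norm_1_psd QVQ)
  finally show "schatten_dist 1 (conj_transpose B ** B) (set_F A) \<le> (norm (B ** Q))\<^sup>2"
    by (simp add: tr V_def trace_kernel_projector)
qed

text \<open>At such a point the objective is 0, and it is nowhere negative, being an infimum of
  norms over a set that contains \<open>V\<close>.\<close>

lemma weak_phaselift_minimizer_feasible:
  assumes "V \<in> psd_mats" "V \<in> set_F A" "V \<in> set_H c"
  shows "weak_phaselift_minimizer s A c V"
proof -
  have "schatten_dist s V (set_H c) \<le> schatten_norm s (V - V)"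
    unfolding schatten_dist_def using assms by (intro cINF_lower bdd_belowI2[of _ 0]) auto
  then have "schatten_dist s V (set_H c) \<le> 0" by simp
  moreover have "0 \<le> schatten_dist s W (set_H c)" for W
    unfolding schatten_dist_def using assms by (intro cINF_greatest) auto
  ultimately show ?thesis
    using assms by (simp add: weak_phaselift_minimizer_def is_arg_min_def not_less)
      (meson order_trans)
qed

text \<open>The competitor gives \<open>y\<close> the prescribed moduli \<open>b\<close> and keeps its phases; since \<open>Q\<close> annihilates
  \<open>y\<close>, its PhaseCut objective only sees the noise.\<close>
lemma phasecut_minimizer_residual_le:
  fixes B :: "complex^'n^'k"
  assumes min: "phasecut_minimizer A (entrywise_cmod (A *v x0) + e) (conj_transpose B ** B)"
  shows "norm (B ** Q) \<le> norm e"
proof -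
  define y where "y = A *v x0"
  define b where "b = entrywise_cmod y + e"
  \<comment> \<open>Where \<open>y $ i = 0\<close>, \<open>sgn\<close> would give 0; the default 1
    keeps every phase unimodular, so that \<open>v\<close> gets the modulus \<bar>b\<bar> there
    too.\<close>
  define p where "p i = (if y $ i = 0 then 1 else sgn (y $ i))" for i
  have p: "cmod (p i) = 1" "complex_of_real (cmod (y $ i)) * p i = y $ i" for i
    by (auto simp: p_def norm_sgn sgn_eq norm_divide)
  define z where "z = (\<chi> i. complex_of_real (e $ i) * p i)"
  define v where "v = y + z"
  have v: "v $ i = complex_of_real (b $ i) * p i" for i
    using p(2)[of i] by (simp add: v_def z_def b_def entrywise_cmod_def algebra_simps)
  have "rank_one v \<in> set_H b"
    by (rule rank_one_in_set_H) (simp add: v norm_mult p)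
  then have "schatten_dist 1 (conj_transpose B ** B) (set_F A) \<le> schatten_dist 1 (rank_one v) (set_F A)"
    using min rank_one_psd[of v]
    by (auto simp: phasecut_minimizer_def is_arg_min_def b_def y_def not_less)
  then have "(norm (B ** Q))\<^sup>2 \<le> (norm (row_mat v ** Q))\<^sup>2"
    by (simp only: schatten_dist_set_F flip: gram_row_mat)
  then have "norm (B ** Q) \<le> norm (Q *v v)"
    by (simp add: row_mat_mult kernel_projector power2_le_iff_abs_le)
  also have "Q *v v = Q *v z"
    by (simp add: v_def y_def matrix_vector_right_distrib matrix_vector_mul_assoc kernel_projector)
  also have "norm (Q *v z) \<le> norm z"
    by (rule norm_projector_mult_vec_le) (rule kernel_projector)+
  also have "norm z = norm e"
    by (simp add: norm_vec_def z_def norm_mult p)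
  finally show ?thesis .
qed

text \<open>The stability hypothesis speaks only of Weak PhaseLift minimizers, and \<open>V\<close>
  need not lie in \<open>set_F A\<close>. Hence \<open>V\<close> is compressed into that set first,
  and the data \<open>c\<close> are read off the diagonal of the result.\<close>

lemma phasecut_minimizer_projection:
  assumes min: "phasecut_minimizer A (entrywise_cmod (A *v x0) + e) V"
  obtains c where "norm (c - entrywise_cmod (A *v x0)) \<le> 2 * norm e"
    "weak_phaselift_minimizer s A c (P ** V ** P)"
    "norm (V - P ** V ** P) \<le> sqrt 2 * (norm (A *v x0) + norm e) * norm e + (norm e)\<^sup>2"
proof -
  define y where "y = A *v x0"
  define b where "b = entrywise_cmod y + e"
  have V: "V \<in> psd_mats" and VH: "V \<in> set_H b"
    using min by (auto simp: phasecut_minimizer_def is_arg_min_def b_def y_def)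
  obtain B :: "complex^'n^'n" where B: "V = conj_transpose B ** B"
    using psd_sqrt[OF V] .
  have BQ: "norm (B ** Q) \<le> norm e"
    using min unfolding B by (rule phasecut_minimizer_residual_le)
  have "complex_of_real ((norm (column i B))\<^sup>2) = of_real ((b $ i)\<^sup>2)" for i
    using VH unfolding set_H_def B by (simp only: gram_diagonal mem_Collect_eq)
  then have "(norm (column i B))\<^sup>2 = (b $ i)\<^sup>2" for i
    by (simp only: of_real_eq_iff)
  then have col: "norm (column i B) = \<bar>b $ i\<bar>" for i
    by (metis norm_ge_zero abs_of_nonneg real_sqrt_abs)
  have "(norm B)\<^sup>2 = (norm b)\<^sup>2"
    by (simp add: norm_matrix_sq_columns col) (simp add: norm_vec_def L2_set_def sum_nonneg)
  then have normB: "norm B = norm b" by (rule power2_eq_imp_eq) auto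
  have "(norm (B ** P))\<^sup>2 \<le> (norm B)\<^sup>2"
    using norm_mult_projector_complement[OF range_projector, of B]
      zero_le_power2[of "norm (B ** Q)"] unfolding Q_def by linarith
  then have BP: "norm (B ** P) \<le> norm b" unfolding normB by (rule power2_le_imp_le) auto
  have Ph: "conj_transpose P = P" and Qh: "conj_transpose Q = Q"
    using range_projector kernel_projector by (simp_all add: hermitian_iff)
  have PVP: "P ** V ** P = conj_transpose (B ** P) ** (B ** P)"
    by (simp add: B conj_transpose_mult Ph matrix_mul_assoc)
  define c where "c = (\<chi> i. norm (column i (B ** P)))"
  have "Q ** (P ** V ** P) ** Q = (Q ** P) ** V ** (P ** Q)"
    by (simp add: matrix_mul_assoc)
  then have "P ** V ** P \<in> set_F A"
    by (simp add: set_F_iff kernel_projector PVP hermitian_gram)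
  moreover have "P ** V ** P \<in> set_H c"
    unfolding PVP set_H_def by (simp add: gram_diagonal hermitian_gram c_def)
  ultimately have "weak_phaselift_minimizer s A c (P ** V ** P)"
    by (intro weak_phaselift_minimizer_feasible) (simp_all add: PVP psd_gram)
  moreover have "norm (c - entrywise_cmod y) \<le> 2 * norm e"
  proof -
    \<comment> \<open>The column norms of \<open>B\<close> lie between the two data vectors. Passing
      from \<open>c\<close> to \<open>a\<close> costs \<open>norm (B ** Q)\<close>, by the reverse
      triangle inequality on columns; passing from \<open>a\<close> to the moduli of
      \<open>y\<close> costs \<open>norm e\<close>.\<close>
    define a where "a = (\<chi> i. \<bar>b $ i\<bar>)"
    have "norm (c - a) \<le> norm (\<chi> i. norm (column i (B ** Q)))"
    proof (rule norm_le_componentwise_cart)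
      fix i
      have "B ** Q = B - B ** P" by (simp add: Q_def matrix_diff_ldistrib)
      then have "column i (B ** Q) = column i B - column i (B ** P)"
        by (simp add: column_def vec_eq_iff)
      then show "norm ((c - a) $ i) \<le> norm ((\<chi> i. norm (column i (B ** Q))) $ i)"
        using norm_triangle_ineq3[of "column i B" "column i (B ** P)"]
        by (simp add: c_def a_def col)
    qed
    also have "\<dots> = norm (B ** Q)"
      by (rule power2_eq_imp_eq)
        (simp_all add: norm_matrix_sq_columns, simp add: norm_vec_def L2_set_def sum_nonneg)
    finally have "norm (c - a) \<le> norm e" using BQ by simp
    moreover have "norm (a - entrywise_cmod y) \<le> norm e"
    proof (rule norm_le_componentwise_cart)
      fix i
      have "\<bar>\<bar>cmod (y $ i) + e $ i\<bar> - cmod (y $ i)\<bar> \<le> \<bar>e $ i\<bar>"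
        using norm_ge_zero[of "y $ i"] by linarith
      then show "norm ((a - entrywise_cmod y) $ i) \<le> norm (e $ i)"
        by (simp add: a_def b_def entrywise_cmod_def)
    qed
    ultimately show ?thesis
      using norm_triangle_ineq[of "c - a" "a - entrywise_cmod y"] by simp
  qed
  moreover have "norm (V - P ** V ** P) \<le> sqrt 2 * (norm y + norm e) * norm e + (norm e)\<^sup>2"
  proof -
    define X where "X = conj_transpose (B ** P) ** (B ** Q)"
    define Y where "Y = conj_transpose (B ** Q) ** (B ** Q)"
    have X: "X = P ** V ** Q" and Y: "Y = Q ** V ** Q"
      by (simp_all add: X_def Y_def B conj_transpose_mult Ph Qh matrix_mul_assoc)
    have Xt: "conj_transpose X = Q ** V ** P"
      by (simp add: X_def B conj_transpose_mult Ph Qh matrix_mul_assoc)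
    have "V = (P + Q) ** V ** (P + Q)" by (simp add: Q_def)
    also have "\<dots> = P ** V ** P + (X + conj_transpose X + Y)"
      unfolding X Y Xt[unfolded X] by (simp add: matrix_add_ldistrib matrix_add_rdistrib)
    finally have split: "V - P ** V ** P = X + conj_transpose X + Y" by (simp add: algebra_simps)
    \<comment> \<open>Since \<open>Q ** P = 0\<close>, the cross terms in the Gram matrix of the sum
      of \<open>X\<close> and its adjoint vanish. Pythagoras then gives the factor
      \<open>sqrt 2\<close> where the triangle inequality would give 2.\<close>
    have "X ** X = P ** V ** (Q ** P) ** V ** Q" by (simp add: X matrix_mul_assoc)
    then have XX: "X ** X = 0" by (simp add: kernel_projector)
    then have "conj_transpose X ** conj_transpose X = 0" by (simp flip: conj_transpose_mult)
    with XX have "conj_transpose (X + conj_transpose X) ** (X + conj_transpose X)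
        = conj_transpose X ** X + conj_transpose (conj_transpose X) ** conj_transpose X"
      by (simp add: conj_transpose_add matrix_add_ldistrib matrix_add_rdistrib)
    then have "(norm (X + conj_transpose X))\<^sup>2 = (norm X)\<^sup>2 + (norm (conj_transpose X))\<^sup>2"
      by (simp only: norm_matrix_sq_trace trace_add plus_complex.sel)
    then have "(norm (X + conj_transpose X))\<^sup>2 = (sqrt 2 * norm X)\<^sup>2"
      by (simp add: power_mult_distrib)
    then have "norm (X + conj_transpose X) = sqrt 2 * norm X"
      by (rule power2_eq_imp_eq) auto
    moreover have "norm X \<le> (norm y + norm e) * norm e"
    proof -
      have "norm X \<le> norm (B ** P) * norm (B ** Q)"
        unfolding X_def by (rule norm_conj_transpose_mult_le)
      also have "\<dots> \<le> norm b * norm e"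
        by (intro mult_mono BP BQ) auto
      also have "norm b \<le> norm y + norm e"
        unfolding b_def by (rule order_trans[OF norm_triangle_ineq]) simp
      finally show ?thesis by (simp add: mult_right_mono)
    qed
    moreover have "norm Y \<le> (norm e)\<^sup>2"
    proof -
      have "norm Y \<le> norm (B ** Q) * norm (B ** Q)"
        unfolding Y_def by (rule norm_conj_transpose_mult_le)
      also have "\<dots> \<le> norm e * norm e"
        by (intro mult_mono BQ) auto
      finally show ?thesis by (simp add: power2_eq_square)
    qed
    ultimately show ?thesis
      unfolding split using norm_triangle_ineq[of "X + conj_transpose X" Y]
      by (simp add: mult.assoc) (smt (verit) mult_left_mono real_sqrt_ge_zero)
  qed
  ultimately show ?thesis using that by (simp add: y_def)
qed

lemma rank_one_in_set_F: "rank_one (A *v x) \<in> set_F A"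
proof -
  have "Q ** rank_one (A *v x) ** Q = conj_transpose (row_mat (A *v x) ** Q) ** (row_mat (A *v x) ** Q)"
    using kernel_projector(1)
    by (simp add: conj_transpose_mult hermitian_iff matrix_mul_assoc flip: gram_row_mat)
  also have "row_mat (A *v x) ** Q = 0"
    by (simp add: row_mat_mult kernel_projector matrix_vector_mul_assoc)
      (simp add: row_mat_def vec_eq_iff)
  finally show ?thesis
    using rank_one_psd[of "A *v x"] by (simp add: set_F_iff psd_iff)
qed

text \<open>When \<open>A x0 = 0\<close>, every small \<open>w = A x\<close> makes \<open>w w\<^sup>*\<close> a Weak PhaseLift minimizer,
  whereas stability would force it to vanish.\<close>
lemma weak_phaselift_not_stable:
  assumes "A \<noteq> 0" "A *v x0 = 0"
  shows "\<not> weak_phaselift_stable s A C x0"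
proof
  assume "weak_phaselift_stable s A C x0"
  then obtain d where "d > 0" and d: "\<And>e V. norm e < d \<Longrightarrow>
      weak_phaselift_minimizer s A (entrywise_cmod (A *v x0) + e) V \<Longrightarrow>
      schatten_norm 2 (V - rank_one (A *v x0)) \<le> C * norm (A *v x0) * norm e"
    unfolding weak_phaselift_stable_def stable_at_iff by blast
  obtain x where x: "A *v x \<noteq> 0"
    using assms(1) matrix_eq[of A 0] by auto
  \<comment> \<open>Scaled to norm \<open>d / 2\<close>, so that its moduli are an admissible noise
    vector.\<close>
  define w where "w = A *v ((d / (2 * norm (A *v x))) *\<^sub>R x)"
  have "norm w = d / 2"
    using x \<open>d > 0\<close> by (simp add: w_def linear_cmul[OF matrix_vector_mul_linear])
  have "weak_phaselift_minimizer s A (entrywise_cmod w) (rank_one w)"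
    by (intro weak_phaselift_minimizer_feasible rank_one_psd rank_one_in_set_H)
      (simp_all add: w_def rank_one_in_set_F entrywise_cmod_def)
  moreover have "entrywise_cmod (A *v x0) = 0"
    by (simp add: assms entrywise_cmod_def vec_eq_iff)
  ultimately have "schatten_norm 2 (rank_one w) \<le> 0"
    using d[of "entrywise_cmod w" "rank_one w"] \<open>norm w = d / 2\<close> \<open>d > 0\<close> by (simp add: assms)
  then have "rank_one w = 0"
    using rank_one_psd[of w] by (simp add: schatten_norm_2_hermitian psd_iff)
  then show False
    using \<open>norm w = d / 2\<close> \<open>d > 0\<close> by (simp add: rank_one_eq_0_iff)
qed

lemma phasecut_stable_if_weak_phaselift_stable:
  assumes "C > 0" "A *v x0 \<noteq> 0" and WPL: "weak_phaselift_stable s A C x0"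
  shows "phasecut_stable A (2 * C + 2 * sqrt 2 + 1) x0"
proof -
  define y where "y = A *v x0"
  obtain d where "d > 0" and d: "\<And>e V. norm e < d \<Longrightarrow>
      weak_phaselift_minimizer s A (entrywise_cmod y + e) V \<Longrightarrow>
      schatten_norm 2 (V - rank_one y) \<le> C * norm y * norm e"
    using WPL unfolding weak_phaselift_stable_def stable_at_iff y_def by blast
  \<comment> \<open>The radius is \<open>d / 2\<close> because the noise
    \<open>c - entrywise_cmod y\<close> may be twice as large as \<open>e\<close>; the bound by
    \<open>norm y\<close> absorbs the terms quadratic in \<open>e\<close>.\<close>
  have "schatten_norm 2 (V - rank_one y) \<le> (2 * C + 2 * sqrt 2 + 1) * norm y * norm e"
    if e: "norm e < min (d / 2) (norm y)" and min: "phasecut_minimizer A (entrywise_cmod y + e) V" for e V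
  proof -
    have V: "V \<in> hermitian_mats"
      using min by (simp add: phasecut_minimizer_def is_arg_min_def psd_iff)
    obtain c where c: "norm (c - entrywise_cmod y) \<le> 2 * norm e"
      and WPL': "weak_phaselift_minimizer s A c (P ** V ** P)"
      and VP: "norm (V - P ** V ** P) \<le> sqrt 2 * (norm y + norm e) * norm e + (norm e)\<^sup>2"
      using phasecut_minimizer_projection[of x0 e V s] min unfolding y_def by blast
    have PVP: "P ** V ** P \<in> hermitian_mats"
      using WPL' by (simp add: weak_phaselift_minimizer_def is_arg_min_def psd_iff)
    have R: "rank_one y \<in> hermitian_mats" using rank_one_psd[of y] by (simp add: psd_iff)
    have "norm (P ** V ** P - rank_one y) = schatten_norm 2 (P ** V ** P - rank_one y)"
      using PVP R by (simp add: schatten_norm_2_hermitian hermitian_diff)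
    also have "\<dots> \<le> C * norm y * norm (c - entrywise_cmod y)"
      using c e WPL' by (intro d) auto
    also have "\<dots> \<le> C * norm y * (2 * norm e)"
      using c \<open>C > 0\<close> by (intro mult_left_mono) auto
    finally have "norm (V - rank_one y) \<le> C * norm y * (2 * norm e)
        + (sqrt 2 * (norm y + norm e) * norm e + (norm e)\<^sup>2)"
      using VP norm_triangle_ineq[of "P ** V ** P - rank_one y" "V - P ** V ** P"] by simp
    also have "\<dots> \<le> C * norm y * (2 * norm e)
        + (sqrt 2 * (norm y + norm y) * norm e + norm y * norm e)"
      unfolding power2_eq_square using e by (intro add_mono mult_right_mono mult_left_mono) auto
    also have "\<dots> = (2 * C + 2 * sqrt 2 + 1) * norm y * norm e"
      by (simp add: algebra_simps)
    finally show ?thesis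
      using V R by (simp add: schatten_norm_2_hermitian hermitian_diff)
  qed
  moreover have "0 < min (d / 2) (norm y)" using \<open>d > 0\<close> assms by (simp add: y_def)
  ultimately show ?thesis
    unfolding phasecut_stable_def stable_at_iff y_def[symmetric] by blast
qed

end

theorem theorem4p7:
  fixes A :: "complex^'m^'n" and s :: real
  assumes "s \<ge> 1" and "A \<noteq> 0"
  shows "\<forall>(x0 :: complex^'m) (C :: real). C > 0 \<longrightarrow> weak_phaselift_stable s A C x0
           \<longrightarrow> phasecut_stable A (2 * C + 2 * sqrt 2 + 1) x0"
  using weak_phaselift_not_stable[OF assms(2)] phasecut_stable_if_weak_phaselift_stable by metis

end
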